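(* Suppose the DAE $\dot y=f(y,z,t)$, $0=g(y,z,t)$ is semi-explicit index-1 with true solution $[y,z]^T$, and let $[Y,Z]^T$ be its numerical solution. Let $\zeta^y\in\mathbb{R}^n$, $\zeta^z\in\mathbb{R}^m$, and let $(\phi^{(y)},\phi^{(z)})$ solve the adjoint problem with $\psi^y(t)=0$, $\psi^z(t)=0$, i.e. $$-\dot{\phi}^{(y)}=\bar f_y^T\phi^{(y)}+\bar g_y^T\phi^{(z)},\qquad 0=\bar f_z^T\phi^{(y)}+\bar g_z^T\phi^{(z)},\qquad t\in[0,T),$$ with adjoint initial condition $$\phi^{(y)}(T)=\zeta^y-\bar g_y^T\left(\bar g_z^T\right)^{-1}\Bigr|_{t=T}\zeta^z.$$ Then the error $e^{\mathcal{Q}_T}=(e^{(y)}(T),\zeta^y)+(e^{(z)}(T),\zeta^z)$ in the computed quantity of interest $\mathcal{Q}_T(Y,Z)$ is given by $$e^{\mathcal{Q}_T}=\big(\phi^{(y)}(0),e^{(y)}(0)\big)+\langle\phi^{(y)},f(Y,Z)-\dot Y\rangle+\langle\phi^{(z)},g(Y,Z)\rangle.$$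
   Context: Setting: $y(t)\in\mathbb{R}^n$, $z(t)\in\mathbb{R}^m$, $t\in[0,T]$; $f$ takes values in $\mathbb{R}^n$, $g$ in $\mathbb{R}^m$, both smooth enough that all derivatives that appear exist and are continuous. The DAE is index-1 if $g_z=\partial g/\partial z$ is invertible in a neighborhood of the solution. Explicit dependence on $t$ is suppressed: $f(Y,Z)$ means $f(Y(t),Z(t),t)$, etc. Numerical solution: with $t_k=k\Delta t$, $\Delta t=T/N$ (so $t_N=T$), $Y_0=y(0)$, $Z_0=z(0)$, the values satisfy the BDF-1 (implicit Euler) equations $Y_{k+1}=Y_k+\Delta t\,f(Y_{k+1},Z_{k+1},t_{k+1})$, $0=g(Y_{k+1},Z_{k+1},t_{k+1})$, $k=0,\dots,N-1$. $Y(t),Z(t)$ are the continuous piecewise linear interpolants of these values. The derivative $\dot Y$ is taken piecewise. $e^{(y)}=y-Y$, $e^{(z)}=z-Z$. $(\cdot,\cdot)$ is the Euclidean inner product and $\langle a,b\rangle=\int_0^T(a(t),b(t))\,dt$. $\mathcal{Q}_T(y,z)=(y(T),\zeta^y)+(z(T),\zeta^z)$ and $e^{\mathcal{Q}_T}=\mathcal{Q}_T(y,z)-\mathcal{Q}_T(Y,Z)$. Linearized operators (functions of $t$): $\bar f_y=\int_0^1\frac{\partial f}{\partial y}(\tilde y,\tilde z,t)ds$, $\bar f_z=\int_0^1\frac{\partial f}{\partial z}(\tilde y,\tilde z,t)ds$, $\bar g_y=\int_0^1\frac{\partial g}{\partial y}(\tilde y,\tilde z,t)ds$, $\bar g_z=\int_0^1\frac{\partial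 g}{\partial z}(\tilde y,\tilde z,t)ds$, with $\tilde y=sy+(1-s)Y$, $\tilde z=sz+(1-s)Z$. Adjoint variables: $\phi^{(y)}(t)\in\mathbb{R}^n$ is continuous on $[0,T]$ (absolutely continuous, equations holding for almost every $t$), $\phi^{(z)}(t)\in\mathbb{R}^m$ is square integrable. $\phi^{(z)}(T)$ is the consistent value $-[\bar g_z^T]^{-1}\bar f_z^T\phi^{(y)}|_{t=T}$. The numerical solution is assumed close enough to the true one that $\bar g_z$ is invertible. *)

theory Defs
  imports "HOL-Analysis.Analysis"
begin

type_synonym ('n, 'm, 'k) semi_field = "real^'n \<Rightarrow> real^'m \<Rightarrow> real \<Rightarrow> real^'k"

definition partial_y :: "('n::finite, 'm::finite, 'k::finite) semi_field \<Rightarrow> real^'n \<Rightarrow> real^'m \<Rightarrow> real \<Rightarrow> real^'n^'k"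
  where "partial_y F u v t = jacobian (\<lambda>u'. F u' v t) (at u)"

definition partial_z :: "('n::finite, 'm::finite, 'k::finite) semi_field \<Rightarrow> real^'n \<Rightarrow> real^'m \<Rightarrow> real \<Rightarrow> real^'m^'k"
  where "partial_z F u v t = jacobian (\<lambda>v'. F u v' t) (at v)"

text \<open>The regularity of the data: only the derivatives in \<open>y\<close> and \<open>z\<close> occur in the error
  representation, so no differentiability in \<open>t\<close> is imposed.\<close>

definition smooth_data :: "real \<Rightarrow> ('n::finite, 'm::finite, 'k::finite) semi_field \<Rightarrow> bool"
  where "smooth_data T F \<longleftrightarrow>
    continuous_on (UNIV \<times> UNIV \<times> {0..T}) (\<lambda>(u, v, t). F u v t) \<and>
    (\<forall>u v. \<forall>t\<in>{0..T}. (\<lambda>u'. F u' v t) differentiable (at u)) \<and>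
    (\<forall>u v. \<forall>t\<in>{0..T}. (\<lambda>v'. F u v' t) differentiable (at v)) \<and>
    continuous_on (UNIV \<times> UNIV \<times> {0..T}) (\<lambda>(u, v, t). partial_y F u v t) \<and>
    continuous_on (UNIV \<times> UNIV \<times> {0..T}) (\<lambda>(u, v, t). partial_z F u v t)"

text \<open>A classical solution. Since \<open>z\<close> is continuous, \<open>y\<close> is continuously differentiable whenever
  \<open>f\<close> is continuous.\<close>

definition dae_solution ::
    "('n::finite, 'm::finite, 'n) semi_field \<Rightarrow> ('n, 'm, 'm) semi_field \<Rightarrow> real
      \<Rightarrow> (real \<Rightarrow> real^'n) \<Rightarrow> (real \<Rightarrow> real^'m) \<Rightarrow> bool"
  where "dae_solution f g T y z \<longleftrightarrow>
    continuous_on {0..T} z \<and>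
    (\<forall>t\<in>{0..T}. (y has_vector_derivative f (y t) (z t) t) (at t within {0..T})) \<and>
    (\<forall>t\<in>{0..T}. g (y t) (z t) t = 0)"

definition index1_along ::
    "('n::finite, 'm::finite, 'm) semi_field \<Rightarrow> real \<Rightarrow> (real \<Rightarrow> real^'n) \<Rightarrow> (real \<Rightarrow> real^'m) \<Rightarrow> bool"
  where "index1_along g T y z \<longleftrightarrow>
    (\<exists>U. open U \<and> (\<forall>t\<in>{0..T}. (y t, z t, t) \<in> U) \<and>
      (\<forall>(u, v, t)\<in>U. t \<in> {0..T} \<longrightarrow> invertible (partial_z g u v t)))"

definition bdf1_values ::
    "('n::finite, 'm::finite, 'n) semi_field \<Rightarrow> ('n, 'm, 'm) semi_field \<Rightarrow> real \<Rightarrow> nat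
      \<Rightarrow> real^'n \<Rightarrow> real^'m \<Rightarrow> (nat \<Rightarrow> real^'n) \<Rightarrow> (nat \<Rightarrow> real^'m) \<Rightarrow> bool"
  where "bdf1_values f g h N y0 z0 Yn Zn \<longleftrightarrow>
    Yn 0 = y0 \<and> Zn 0 = z0 \<and>
    (\<forall>k<N. Yn (Suc k) = Yn k + h *\<^sub>R f (Yn (Suc k)) (Zn (Suc k)) (real (Suc k) * h) \<and>
           g (Yn (Suc k)) (Zn (Suc k)) (real (Suc k) * h) = 0)"

definition linear_interpolant :: "real \<Rightarrow> nat \<Rightarrow> (nat \<Rightarrow> 'a::real_vector) \<Rightarrow> (real \<Rightarrow> 'a) \<Rightarrow> bool"
  where "linear_interpolant h N X x \<longleftrightarrow>
    (\<forall>k<N. \<forall>t\<in>{real k * h..real (Suc k) * h}.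
       x t = X k + ((t - real k * h) / h) *\<^sub>R (X (Suc k) - X k))"

definition mean_partial_y ::
    "('n::finite, 'm::finite, 'k::finite) semi_field \<Rightarrow> (real \<Rightarrow> real^'n) \<Rightarrow> (real \<Rightarrow> real^'m)
      \<Rightarrow> (real \<Rightarrow> real^'n) \<Rightarrow> (real \<Rightarrow> real^'m) \<Rightarrow> real \<Rightarrow> real^'n^'k"
  where "mean_partial_y F y z Y Z t =
    integral {0..1} (\<lambda>s. partial_y F (s *\<^sub>R y t + (1 - s) *\<^sub>R Y t) (s *\<^sub>R z t + (1 - s) *\<^sub>R Z t) t)"

definition mean_partial_z ::
    "('n::finite, 'm::finite, 'k::finite) semi_field \<Rightarrow> (real \<Rightarrow> real^'n) \<Rightarrow> (real \<Rightarrow> real^'m)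
      \<Rightarrow> (real \<Rightarrow> real^'n) \<Rightarrow> (real \<Rightarrow> real^'m) \<Rightarrow> real \<Rightarrow> real^'m^'k"
  where "mean_partial_z F y z Y Z t =
    integral {0..1} (\<lambda>s. partial_z F (s *\<^sub>R y t + (1 - s) *\<^sub>R Y t) (s *\<^sub>R z t + (1 - s) *\<^sub>R Z t) t)"

text \<open>Absolute continuity on a compact interval, with the finite families of nonoverlapping
  subintervals given as divisions of their union.\<close>

definition abs_continuous_on_interval :: "real \<Rightarrow> real \<Rightarrow> (real \<Rightarrow> 'a::real_normed_vector) \<Rightarrow> bool"
  where "abs_continuous_on_interval a b x \<longleftrightarrow>
    (\<forall>\<epsilon>>0. \<exists>\<delta>>0. \<forall>\<D>. \<D> division_of \<Union>\<D> \<and> \<Union>\<D> \<subseteq> {a..b} \<and> (\<Sum>K\<in>\<D>. Sup K - Inf K) < \<delta>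
       \<longrightarrow> (\<Sum>K\<in>\<D>. norm (x (Sup K) - x (Inf K))) < \<epsilon>)"

definition square_integrable_on :: "(real \<Rightarrow> 'a::euclidean_space) \<Rightarrow> real set \<Rightarrow> bool"
  where "square_integrable_on x S \<longleftrightarrow>
    x \<in> borel_measurable (lebesgue_on S) \<and> integrable (lebesgue_on S) (\<lambda>t. (norm (x t))\<^sup>2)"

text \<open>A Lebesgue integral, hence insensitive to the finitely many nodes at which a piecewise
  linear interpolant fails to be differentiable and its \<^const>\<open>vector_derivative\<close> is
  unspecified.\<close>

definition L2_pairing :: "real \<Rightarrow> (real \<Rightarrow> 'a::euclidean_space) \<Rightarrow> (real \<Rightarrow> 'a) \<Rightarrow> real"
  where "L2_pairing T a b = set_lebesgue_integral lebesgue {0..T} (\<lambda>t. a t \<bullet> b t)"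

definition adjoint_solution ::
    "(real \<Rightarrow> real^'n^'n) \<Rightarrow> (real \<Rightarrow> real^'m^'n) \<Rightarrow> (real \<Rightarrow> real^'n^'m) \<Rightarrow> (real \<Rightarrow> real^'m^'m)
      \<Rightarrow> real \<Rightarrow> real^'n \<Rightarrow> real^'m \<Rightarrow> (real \<Rightarrow> real^'n::finite) \<Rightarrow> (real \<Rightarrow> real^'m::finite) \<Rightarrow> bool"
  where "adjoint_solution fy fz gy gz T \<zeta>y \<zeta>z \<phi>y \<phi>z \<longleftrightarrow>
    abs_continuous_on_interval 0 T \<phi>y \<and>
    square_integrable_on \<phi>z {0..T} \<and>
    (AE t\<in>{0..<T} in lebesgue.
       (\<phi>y has_vector_derivative - (transpose (fy t) *v \<phi>y t + transpose (gy t) *v \<phi>z t))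
         (at t within {0..T}) \<and>
       transpose (fz t) *v \<phi>y t + transpose (gz t) *v \<phi>z t = 0) \<and>
    \<phi>y T = \<zeta>y - transpose (gy T) *v (matrix_inv (transpose (gz T)) *v \<zeta>z) \<and>
    \<phi>z T = - (matrix_inv (transpose (gz T)) *v (transpose (fz T) *v \<phi>y T))"

definition terminal_qoi ::
    "real \<Rightarrow> real^'n \<Rightarrow> real^'m \<Rightarrow> (real \<Rightarrow> real^'n::finite) \<Rightarrow> (real \<Rightarrow> real^'m::finite) \<Rightarrow> real"
  where "terminal_qoi T \<zeta>y \<zeta>z y z = y T \<bullet> \<zeta>y + z T \<bullet> \<zeta>z"

end

theory Submission
  imports Defs
begin

text \<open>The argument is duality. Along the true and the numerical solution, the averaged partial
  derivatives linearize \<^term>\<open>f\<close> and \<^term>\<open>g\<close> exactly (lemma \<open>mean_value_linearization\<close>), so the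
  error solves a linear differential-algebraic equation whose inhomogeneities are the residuals
  \<open>f(Y,Z) - Y'\<close> and \<open>g(Y,Z)\<close>. The adjoint variables solve the transposed system. Hence in the
  derivative of \<open>(\<phi>y, y - Y)\<close> all terms containing the errors cancel, and only the residuals
  weighted by \<open>\<phi>y\<close> and \<open>\<phi>z\<close> remain (lemma \<open>adjoint_pairing_residual\<close>). Integrating from \<open>0\<close> to
  \<open>T\<close> expresses \<open>(\<phi>y(T), y(T) - Y(T))\<close> by the initial error and the two weighted residuals.

  At the final time, implicit Euler satisfies the constraint exactly, so the error in \<open>z\<close> is
  determined by the error in \<open>y\<close>. The terminal value of the adjoint is the one for which
  \<open>(\<phi>y(T), y(T) - Y(T))\<close> is the error in the quantity of interest (lemma
  \<open>terminal_error_dual\<close>).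

  The adjoint is only absolutely continuous and solves its equations almost everywhere, so the
  integration step needs the fundamental theorem of calculus for absolutely continuous functions
  (lemmas \<open>abs_continuous_FTC\<close> and \<open>abs_continuous_integration_by_parts\<close>).\<close>

section \<open>Absolutely continuous functions\<close>

text \<open>The gauge integral yields the integrability of \<^term>\<open>x'\<close> together with the value of the
  integral. Off the exceptional set \<^term>\<open>E\<close> the gauge is the radius on which the linear
  approximation is accurate. On \<^term>\<open>E\<close> it is an open superset of small measure, so that the
  intervals tagged there have small total length and absolute continuity bounds their
  contribution to the telescoping sum for \<^term>\<open>x b - x a\<close>.\<close>

lemma abs_continuous_FTC:
  fixes x :: "real \<Rightarrow> 'a::real_normed_vector"
  assumes "a \<le> b" and ac: "abs_continuous_on_interval a b x" and E: "negligible E"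
    and der: "\<And>t. t \<in> {a..b} - E \<Longrightarrow> (x has_vector_derivative x' t) (at t within {a..b})"
  shows "(x' has_integral (x b - x a)) {a..b}"
proof -
  \<comment> \<open>Changing the integrand on a null set is harmless, and the value \<open>0\<close> leaves only the
     increment of \<open>x\<close> as the error of an interval tagged in \<open>E\<close>.\<close>
  define g where "g t = (if t \<in> E then 0 else x' t)" for t
  have "(g has_integral (x b - x a)) {a..b}"
    unfolding has_integral_real
  proof (intro allI impI)
    fix e :: real assume "e > 0"
    \<comment> \<open>The summand \<open>1\<close> covers the degenerate interval \<open>a = b\<close>.\<close>
    define e1 where "e1 = e / (2 * (b - a + 1))"
    have "e1 > 0" using \<open>e > 0\<close> \<open>a \<le> b\<close> by (simp add: e1_def)
    have e1: "e1 * (b - a) \<le> e / 2"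
    proof -
      have "e1 * (b - a) \<le> e1 * (b - a + 1)" using \<open>e1 > 0\<close> by simp
      also have "\<dots> = e / 2" using \<open>a \<le> b\<close> by (simp add: e1_def field_simps)
      finally show ?thesis .
    qed
    from ac \<open>e > 0\<close> obtain \<delta> where "\<delta> > 0" and
      \<delta>: "\<And>\<D>. \<lbrakk>\<D> division_of \<Union>\<D>; \<Union>\<D> \<subseteq> {a..b}; (\<Sum>K\<in>\<D>. Sup K - Inf K) < \<delta>\<rbrakk>
               \<Longrightarrow> (\<Sum>K\<in>\<D>. norm (x (Sup K) - x (Inf K))) < e / 2"
      unfolding abs_continuous_on_interval_def by (meson half_gt_zero)
    obtain W where W: "open W" "E \<subseteq> W" "W \<in> lmeasurable" "measure lebesgue W < \<delta>"
    proof -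
      have null: "E \<in> null_sets lebesgue" using E negligible_iff_null_sets by blast
      then have "E \<in> sets lebesgue" by auto
      with \<open>\<delta> > 0\<close> obtain W where "open W" "E \<subseteq> W" "W - E \<in> lmeasurable"
        "emeasure lebesgue (W - E) < ennreal \<delta>"
        using sets_lebesgue_outer_open by blast
      moreover have "W \<in> sets lebesgue" using \<open>open W\<close> by auto
      moreover have "emeasure lebesgue W = emeasure lebesgue (W - E)"
        using emeasure_Diff_null_set[OF null \<open>W \<in> sets lebesgue\<close>] by simp
      ultimately have "emeasure lebesgue W < ennreal \<delta>" by simp
      then have "W \<in> lmeasurable"
        using \<open>W \<in> sets lebesgue\<close> order.strict_trans[OF _ ennreal_less_top] 
        by (intro fmeasurableI) auto
      moreover have "measure lebesgue W < \<delta>"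
        using \<open>emeasure lebesgue W < ennreal \<delta>\<close> \<open>\<delta> > 0\<close> \<open>W \<in> lmeasurable\<close>
        by (simp add: emeasure_eq_measure2 ennreal_less_iff)
      ultimately show ?thesis using \<open>open W\<close> \<open>E \<subseteq> W\<close> that by blast
    qed
    have "\<forall>t. \<exists>d>0. t \<in> {a..b} - E \<longrightarrow>
         (\<forall>s\<in>{a..b}. norm (s - t) < d \<longrightarrow> norm (x s - x t - (s - t) *\<^sub>R x' t) \<le> e1 * norm (s - t))"
    proof
      fix t
      show "\<exists>d>0. t \<in> {a..b} - E \<longrightarrow>
         (\<forall>s\<in>{a..b}. norm (s - t) < d \<longrightarrow> norm (x s - x t - (s - t) *\<^sub>R x' t) \<le> e1 * norm (s - t))"
      proof (cases "t \<in> {a..b} - E")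
        case True
        from der[OF this] \<open>e1 > 0\<close> show ?thesis
          unfolding has_vector_derivative_def has_derivative_within_alt by blast
      qed (use zero_less_one in blast)
    qed
    then obtain d where d: "\<And>t. 0 < d t"
      "\<And>t s. \<lbrakk>t \<in> {a..b} - E; s \<in> {a..b}; norm (s - t) < d t\<rbrakk>
         \<Longrightarrow> norm (x s - x t - (s - t) *\<^sub>R x' t) \<le> e1 * norm (s - t)"
      by metis
    define \<gamma> where "\<gamma> t = (if t \<in> E then W else ball t (d t))" for t
    have "gauge \<gamma>" unfolding gauge_def \<gamma>_def using W d(1) by auto
    moreover have "norm ((\<Sum>(t, K)\<in>p. measure lborel K *\<^sub>R g t) - (x b - x a)) < e"
      if p: "p tagged_division_of {a..b}" and fine: "\<gamma> fine p" for p
    proof -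
      have "finite p" using p by blast
      define q where "q = {(t, K) \<in> p. t \<in> E}"
      have "q \<subseteq> p" by (auto simp: q_def)
      have interval: "\<exists>u v. K = {u..v} \<and> u \<le> v \<and> u \<le> t \<and> t \<le> v \<and> a \<le> u \<and> v \<le> b" if "(t, K) \<in> p" for t K
      proof -
        have "t \<in> K" "K \<subseteq> {a..b}" "\<exists>u v. K = cbox u v" 
          using p that by blast+
        then show ?thesis by auto
      qed
      let ?err = "\<lambda>(t, K). norm (measure lborel K *\<^sub>R g t - (x (Sup K) - x (Inf K)))"
      have "(\<Sum>(t, K)\<in>p. measure lborel K *\<^sub>R g t) - (x b - x a)
          = (\<Sum>(t, K)\<in>p. measure lborel K *\<^sub>R g t - (x (Sup K) - x (Inf K)))"
        by (simp add: additive_tagged_division_1[OF \<open>a \<le> b\<close> p, of x, symmetric]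
            sum_subtractf[symmetric] split_def)
      also have "norm \<dots> \<le> sum ?err p" by (intro order.trans[OF norm_sum]) (auto intro!: sum_mono)
      also have "\<dots> = sum ?err (p - q) + sum ?err q"
        using \<open>finite p\<close> \<open>q \<subseteq> p\<close> by (rule sum.subset_diff[rotated])
      also have "sum ?err (p - q) \<le> e / 2"
      proof -
        have "sum ?err (p - q) \<le> (\<Sum>(t, K)\<in>p - q. e1 * (Sup K - Inf K))"
        proof (rule sum_mono)
          fix r assume "r \<in> p - q"
          then obtain t K where r: "r = (t, K)" and tK: "(t, K) \<in> p" "(t, K) \<notin> q" by (cases r) auto
          then obtain u v where K: "K = {u..v}" "u \<le> v" "u \<le> t" "t \<le> v" "a \<le> u" "v \<le> b"
            using interval by blast
          have "t \<notin> E" using tK by (auto simp: q_def)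
          then have "K \<subseteq> ball t (d t)" using fine tK(1) by (force simp: fine_def \<gamma>_def)
          then have "norm (u - t) < d t" "norm (v - t) < d t"
            using K(1,2) subsetD[of K "ball t (d t)" u] subsetD[of K "ball t (d t)" v]
            by (auto simp: dist_real_def)
          then have uv: "norm (x u - x t - (u - t) *\<^sub>R x' t) \<le> e1 * norm (u - t)"
            "norm (x v - x t - (v - t) *\<^sub>R x' t) \<le> e1 * norm (v - t)"
            using d(2)[of t u] d(2)[of t v] K \<open>t \<notin> E\<close> by auto
          have "norm ((v - u) *\<^sub>R x' t - (x v - x u))
              = norm ((x u - x t - (u - t) *\<^sub>R x' t) - (x v - x t - (v - t) *\<^sub>R x' t))"
            by (simp add: algebra_simps)
          also have "\<dots> \<le> e1 * norm (u - t) + e1 * norm (v - t)"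
            using uv by (meson add_mono norm_triangle_ineq4 order_trans)
          also have "\<dots> = e1 * (v - u)" using K by (simp add: algebra_simps)
          finally show "?err r \<le> (case r of (t, K) \<Rightarrow> e1 * (Sup K - Inf K))"
            using K \<open>t \<notin> E\<close> r by (simp add: g_def)
        qed
        also have "\<dots> \<le> (\<Sum>(t, K)\<in>p. e1 * (Sup K - Inf K))"
        proof (rule sum_mono2[OF \<open>finite p\<close>])
          fix r assume "r \<in> p - (p - q)"
          then obtain t K where r: "r = (t, K)" "(t, K) \<in> p" by (cases r) auto
          then obtain u v where "K = {u..v}" "u \<le> v" using interval by blast
          then show "0 \<le> (case r of (t, K) \<Rightarrow> e1 * (Sup K - Inf K))" using \<open>e1 > 0\<close> r by simp
        qed auto
        also have "\<dots> = e1 * (b - a)"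
          using additive_tagged_division_1[OF \<open>a \<le> b\<close> p, of "\<lambda>t. t"]
          by (simp add: sum_distrib_left[symmetric] split_def)
        finally show ?thesis using e1 by linarith
      qed
      also have "sum ?err q < e / 2"
      proof -
        have q: "q tagged_partial_division_of {a..b}"
          using tagged_partial_division_subset[OF _ \<open>q \<subseteq> p\<close>] p
          by (simp add: tagged_division_of_def)
        let ?D = "snd ` q"
        have div: "?D division_of \<Union>?D" by (rule partial_division_of_tagged_division[OF q])
        have sub: "\<Union>?D \<subseteq> {a..b}" "\<Union>?D \<subseteq> W"
        proof -
          have "K \<subseteq> {a..b} \<and> K \<subseteq> W" if "(t, K) \<in> q" for t K
          proof -
            have "(t, K) \<in> p" "t \<in> E" using that by (auto simp: q_def)
            then show ?thesis using interval[of t K] fineD[OF fine, of t K] by (auto simp: \<gamma>_def)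
          qed
          then show "\<Union>?D \<subseteq> {a..b}" "\<Union>?D \<subseteq> W" by fastforce+
        qed
        \<comment> \<open>Absolute continuity speaks of sets of intervals. One interval can carry several tags,
           but then it is degenerate and contributes nothing, so the sum descends to \<open>?D\<close>.
           The case distinction is there because \<open>Sup {}\<close> is unspecified.\<close>
        let ?osc = "\<lambda>K. if K = {} then 0 else norm (x (Sup K) - x (Inf K))"
        have "sum ?err q = (\<Sum>(t, K)\<in>q. ?osc K)"
        proof (rule sum.cong[OF refl])
          fix r assume "r \<in> q"
          then obtain t K where r: "r = (t, K)" "(t, K) \<in> p" "t \<in> E" by (cases r) (auto simp: q_def)
          moreover have "K \<noteq> {}" using interval[OF r(2)] by auto
          ultimately show "?err r = (case r of (t, K) \<Rightarrow> ?osc K)"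
            by (simp add: g_def norm_minus_commute)
        qed
        also have "\<dots> = (\<Sum>K\<in>?D. ?osc K)"
        proof (rule sum.over_tagged_division_lemma[OF tagged_partial_division_of_Union_self[OF q]])
          fix u v :: real assume "box u v = {}"
          then have "v \<le> u" by simp
          then show "?osc (cbox u v) = 0"
            by (cases "u = v") auto
        qed
        also have "\<dots> \<le> (\<Sum>K\<in>?D. norm (x (Sup K) - x (Inf K)))"
          by (rule sum_mono) simp
        also have "\<dots> < e / 2"
        proof (rule \<delta>[OF div sub(1)])
          have "(\<Sum>K\<in>?D. Sup K - Inf K) = (\<Sum>K\<in>?D. measure lebesgue K)"
          proof (rule sum.cong[OF refl])
            fix K assume "K \<in> ?D"
            then obtain t where "(t, K) \<in> p" using \<open>q \<subseteq> p\<close> by auto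
            then obtain u v where "K = {u..v}" "u \<le> v" using interval by blast
            then show "Sup K - Inf K = measure lebesgue K" by simp
          qed
          also have "\<dots> = measure lebesgue (\<Union>?D)" by (rule content_division[OF div])
          also have "\<dots> \<le> measure lebesgue W"
            using sub(2) W(3) lmeasurable_division[OF div] by (simp add: measure_mono_fmeasurable fmeasurableD)
          finally show "(\<Sum>K\<in>?D. Sup K - Inf K) < \<delta>" using W(4) by simp
        qed
        finally show ?thesis .
      qed
      finally show ?thesis by simp
    qed
    ultimately show "\<exists>\<gamma>. gauge \<gamma> \<and> (\<forall>p. p tagged_division_of {a..b} \<and> \<gamma> fine p \<longrightarrow>
        norm ((\<Sum>(t, K)\<in>p. measure lborel K *\<^sub>R g t) - (x b - x a)) < e)"
      by (intro exI[of _ \<gamma>]) auto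
  qed
  then show ?thesis
    by (rule has_integral_spike[OF E, rotated]) (simp add: g_def)
qed

lemma abs_continuous_imp_continuous_on:
  fixes x :: "real \<Rightarrow> 'a::real_normed_vector"
  assumes "abs_continuous_on_interval a b x"
  shows "continuous_on {a..b} x"
  unfolding continuous_on_iff
proof (intro ballI allI impI)
  fix t and e :: real assume t: "t \<in> {a..b}" and "e > 0"
  with assms obtain \<delta> where "\<delta> > 0" and
    \<delta>: "\<And>\<D>. \<lbrakk>\<D> division_of \<Union>\<D>; \<Union>\<D> \<subseteq> {a..b}; (\<Sum>K\<in>\<D>. Sup K - Inf K) < \<delta>\<rbrakk>
             \<Longrightarrow> (\<Sum>K\<in>\<D>. norm (x (Sup K) - x (Inf K))) < e"
    unfolding abs_continuous_on_interval_def by meson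
  have "norm (x v - x u) < e" if "u \<le> v" "u \<in> {a..b}" "v \<in> {a..b}" "v - u < \<delta>" for u v
    using \<delta>[of "{{u..v}}"] that division_of_self[of u v] by auto
  note close = this
  have "dist (x s) (x t) < e" if "s \<in> {a..b}" "dist s t < \<delta>" for s
    using that close[of s t] close[of t s] t
    by (cases s t rule: le_cases) (auto simp: dist_norm norm_minus_commute)
  with \<open>\<delta> > 0\<close> show "\<exists>d>0. \<forall>s\<in>{a..b}. dist s t < d \<longrightarrow> dist (x s) (x t) < e" by blast
qed

lemma division_endpoints:
  assumes "\<D> division_of \<Union>\<D>" "\<Union>\<D> \<subseteq> {a..b::real}" "K \<in> \<D>"
  shows "Sup K \<in> {a..b}" "Inf K \<in> {a..b}" "Inf K \<le> Sup K"
proof -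
  obtain u v where K: "K = {u..v}" "u \<le> v"
    using division_ofD(3,4)[OF assms(1,3)] by fastforce
  moreover have "K \<subseteq> {a..b}" using assms by blast
  ultimately show "Sup K \<in> {a..b}" "Inf K \<in> {a..b}" "Inf K \<le> Sup K" by auto
qed

lemma lipschitz_imp_abs_continuous:
  fixes x :: "real \<Rightarrow> 'a::real_normed_vector"
  assumes L: "L-lipschitz_on {a..b} x"
  shows "abs_continuous_on_interval a b x"
  unfolding abs_continuous_on_interval_def
proof (intro allI impI)
  fix e :: real assume "e > 0"
  have "L \<ge> 0" using L by (rule lipschitz_on_nonneg)
  have "(\<Sum>K\<in>\<D>. norm (x (Sup K) - x (Inf K))) < e"
    if D: "\<D> division_of \<Union>\<D>" "\<Union>\<D> \<subseteq> {a..b}"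
      and small: "(\<Sum>K\<in>\<D>. Sup K - Inf K) < e / (L + 1)" for \<D>
  proof -
    have "(\<Sum>K\<in>\<D>. norm (x (Sup K) - x (Inf K))) \<le> (\<Sum>K\<in>\<D>. L * (Sup K - Inf K))"
    proof (rule sum_mono)
      fix K assume "K \<in> \<D>"
      from lipschitz_onD[OF L division_endpoints(1,2)[OF D this]] division_endpoints(3)[OF D this]
      show "norm (x (Sup K) - x (Inf K)) \<le> L * (Sup K - Inf K)" by (simp add: dist_norm)
    qed
    also have "\<dots> \<le> L * (e / (L + 1))"
      unfolding sum_distrib_left[symmetric] using small \<open>L \<ge> 0\<close> by (intro mult_left_mono) auto
    also have "\<dots> < e" using \<open>L \<ge> 0\<close> \<open>e > 0\<close> by (simp add: field_simps)
    finally show ?thesis .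
  qed
  moreover have "e / (L + 1) > 0" using \<open>L \<ge> 0\<close> \<open>e > 0\<close> by simp
  ultimately show "\<exists>\<delta>>0. \<forall>\<D>. \<D> division_of \<Union>\<D> \<and> \<Union>\<D> \<subseteq> {a..b} \<and> (\<Sum>K\<in>\<D>. Sup K - Inf K) < \<delta>
       \<longrightarrow> (\<Sum>K\<in>\<D>. norm (x (Sup K) - x (Inf K))) < e" by blast
qed

lemma abs_continuous_inner:
  fixes x w :: "real \<Rightarrow> 'a::real_inner"
  assumes x: "abs_continuous_on_interval a b x" and w: "abs_continuous_on_interval a b w"
  shows "abs_continuous_on_interval a b (\<lambda>t. x t \<bullet> w t)"
  unfolding abs_continuous_on_interval_def
proof (intro allI impI)
  fix e :: real assume "e > 0"
  have "compact (x ` {a..b} \<union> w ` {a..b})"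
    using x w by (intro compact_Un compact_continuous_image abs_continuous_imp_continuous_on) auto
  then have "bounded (x ` {a..b} \<union> w ` {a..b})" by (rule compact_imp_bounded)
  then obtain B where "B > 0" and "\<forall>v\<in>x ` {a..b} \<union> w ` {a..b}. norm v \<le> B"
    unfolding bounded_pos by blast
  then have B: "norm (x t) \<le> B" "norm (w t) \<le> B" if "t \<in> {a..b}" for t
    using that by auto
  define e1 where "e1 = e / (2 * B)"
  have "e1 > 0" using \<open>e > 0\<close> \<open>B > 0\<close> by (simp add: e1_def)
  obtain \<delta>1 where "\<delta>1 > 0" and
    \<delta>1: "\<And>\<D>. \<lbrakk>\<D> division_of \<Union>\<D>; \<Union>\<D> \<subseteq> {a..b}; (\<Sum>K\<in>\<D>. Sup K - Inf K) < \<delta>1\<rbrakk>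
             \<Longrightarrow> (\<Sum>K\<in>\<D>. norm (x (Sup K) - x (Inf K))) < e1"
    using x \<open>e1 > 0\<close> unfolding abs_continuous_on_interval_def by meson
  obtain \<delta>2 where "\<delta>2 > 0" and
    \<delta>2: "\<And>\<D>. \<lbrakk>\<D> division_of \<Union>\<D>; \<Union>\<D> \<subseteq> {a..b}; (\<Sum>K\<in>\<D>. Sup K - Inf K) < \<delta>2\<rbrakk>
             \<Longrightarrow> (\<Sum>K\<in>\<D>. norm (w (Sup K) - w (Inf K))) < e1"
    using w \<open>e1 > 0\<close> unfolding abs_continuous_on_interval_def by meson
  have "(\<Sum>K\<in>\<D>. norm (x (Sup K) \<bullet> w (Sup K) - x (Inf K) \<bullet> w (Inf K))) < e"
    if D: "\<D> division_of \<Union>\<D>" "\<Union>\<D> \<subseteq> {a..b}" and small: "(\<Sum>K\<in>\<D>. Sup K - Inf K) < min \<delta>1 \<delta>2" for \<D>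
  proof -
    have "(\<Sum>K\<in>\<D>. norm (x (Sup K) \<bullet> w (Sup K) - x (Inf K) \<bullet> w (Inf K)))
        \<le> (\<Sum>K\<in>\<D>. B * norm (x (Sup K) - x (Inf K)) + B * norm (w (Sup K) - w (Inf K)))"
    proof (rule sum_mono)
      fix K assume "K \<in> \<D>"
      note ends = division_endpoints(1,2)[OF D this]
      have "x (Sup K) \<bullet> w (Sup K) - x (Inf K) \<bullet> w (Inf K)
          = w (Sup K) \<bullet> (x (Sup K) - x (Inf K)) + x (Inf K) \<bullet> (w (Sup K) - w (Inf K))"
        by (simp add: inner_diff_right inner_commute)
      also have "norm \<dots> \<le> norm (w (Sup K)) * norm (x (Sup K) - x (Inf K))
                          + norm (x (Inf K)) * norm (w (Sup K) - w (Inf K))"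
        by (intro norm_triangle_mono) (simp_all add: Cauchy_Schwarz_ineq2)
      also have "\<dots> \<le> B * norm (x (Sup K) - x (Inf K)) + B * norm (w (Sup K) - w (Inf K))"
        using B ends by (intro add_mono mult_right_mono) auto
      finally show "norm (x (Sup K) \<bullet> w (Sup K) - x (Inf K) \<bullet> w (Inf K))
          \<le> B * norm (x (Sup K) - x (Inf K)) + B * norm (w (Sup K) - w (Inf K))" .
    qed
    also have "\<dots> = B * (\<Sum>K\<in>\<D>. norm (x (Sup K) - x (Inf K))) + B * (\<Sum>K\<in>\<D>. norm (w (Sup K) - w (Inf K)))"
      by (simp add: sum.distrib sum_distrib_left)
    also have "\<dots> < B * e1 + B * e1"
      using \<delta>1[OF D] \<delta>2[OF D] small \<open>B > 0\<close> by (intro add_strict_mono mult_strict_left_mono) auto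
    also have "\<dots> = e" using \<open>B > 0\<close> by (simp add: e1_def)
    finally show ?thesis .
  qed
  with \<open>\<delta>1 > 0\<close> \<open>\<delta>2 > 0\<close>
  show "\<exists>\<delta>>0. \<forall>\<D>. \<D> division_of \<Union>\<D> \<and> \<Union>\<D> \<subseteq> {a..b} \<and> (\<Sum>K\<in>\<D>. Sup K - Inf K) < \<delta>
       \<longrightarrow> (\<Sum>K\<in>\<D>. norm (x (Sup K) \<bullet> w (Sup K) - x (Inf K) \<bullet> w (Inf K))) < e"
    by (intro exI[of _ "min \<delta>1 \<delta>2"]) simp
qed

text \<open>This is meant for the adjoint variable, which is merely absolutely continuous, and the
  numerical error, which is only piecewise smooth: their inner product is still absolutely
  continuous, hence the integral of its almost everywhere derivative.\<close>

lemma abs_continuous_integration_by_parts: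
  fixes x w :: "real \<Rightarrow> 'a::real_inner"
  assumes "a \<le> b" and x: "abs_continuous_on_interval a b x" and w: "abs_continuous_on_interval a b w"
    and "negligible E"
    and "\<And>t. t \<in> {a..b} - E \<Longrightarrow> (x has_vector_derivative x' t) (at t within {a..b})"
    and "\<And>t. t \<in> {a..b} - E \<Longrightarrow> (w has_vector_derivative w' t) (at t within {a..b})"
  shows "((\<lambda>t. x t \<bullet> w' t + x' t \<bullet> w t) has_integral (x b \<bullet> w b - x a \<bullet> w a)) {a..b}"
proof (rule abs_continuous_FTC[OF \<open>a \<le> b\<close> abs_continuous_inner[OF x w] \<open>negligible E\<close>])
  fix t assume "t \<in> {a..b} - E"
  then show "((\<lambda>t. x t \<bullet> w t) has_vector_derivative x t \<bullet> w' t + x' t \<bullet> w t) (at t within {a..b})"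
    by (intro bounded_bilinear.has_vector_derivative[OF bounded_bilinear_inner] assms)
qed

text \<open>The exceptional set accommodates the nodes of a piecewise linear function. Continuity there
  makes the fundamental theorem of calculus applicable across the nodes.\<close>

lemma bounded_derivative_imp_lipschitz:
  fixes x :: "real \<Rightarrow> 'a::banach"
  assumes cont: "continuous_on {a..b} x" and "finite S" and "0 \<le> L"
    and der: "\<And>t. t \<in> {a<..<b} - S \<Longrightarrow> (x has_vector_derivative x' t) (at t)"
    and bound: "\<And>t. t \<in> {a..b} - S \<Longrightarrow> norm (x' t) \<le> L"
  shows "L-lipschitz_on {a..b} x"
proof -
  have "norm (x v - x u) \<le> L * (v - u)" if uv: "u \<le> v" "u \<in> {a..b}" "v \<in> {a..b}" for u v
  proof -
    have "(x' has_integral (x v - x u)) (cbox u v)"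
      using uv der fundamental_theorem_of_calculus_interior_strong[OF \<open>finite S\<close> \<open>u \<le> v\<close>, of x x']
        continuous_on_subset[OF cont, of "{u..v}"] by auto
    from has_integral_bound_spike_finite[OF \<open>0 \<le> L\<close> \<open>finite S\<close> this] bound uv
    show ?thesis by auto
  qed
  note le = this
  have "dist (x u) (x v) \<le> L * dist u v" if "u \<in> {a..b}" "v \<in> {a..b}" for u v
    using le[of u v] le[of v u] that
    by (cases u v rule: le_cases) (auto simp: dist_norm norm_minus_commute)
  with \<open>0 \<le> L\<close> show ?thesis by (auto intro: lipschitz_onI)
qed

section \<open>The averaged linearization\<close>

lemma bounded_linear_matrix_vector_left: "bounded_linear (\<lambda>A :: real^'n^'m. A *v x)"
  by (intro linear_conv_bounded_linear[THEN iffD1] linearI)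
     (simp_all add: matrix_vector_mult_add_rdistrib scaleR_matrix_vector_assoc)

text \<open>Separate differentiability with a continuous partial derivative in the second argument
  already gives the total derivative.\<close>

lemma smooth_data_has_derivative:
  fixes F :: "real^'n \<Rightarrow> real^'m \<Rightarrow> real \<Rightarrow> real^'k"
  assumes F: "smooth_data T F" and t: "t \<in> {0..T}"
  shows "((\<lambda>(u, v). F u v t) has_derivative
           (\<lambda>(a, b). partial_y F u v t *v a + partial_z F u v t *v b)) (at (u, v))"
proof -
  define D where "D u v = Blinfun (\<lambda>b. partial_z F u v t *v b)" for u v
  have D: "blinfun_apply (D u v) = (\<lambda>b. partial_z F u v t *v b)" for u v
    by (simp add: D_def bounded_linear_Blinfun_apply)
  have "((\<lambda>(u, v). F u v t) has_derivative (\<lambda>(a, b). partial_y F u v t *v a + D u v b))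
          (at (u, v) within UNIV \<times> UNIV)"
  proof (rule has_derivative_partialsI)
    show "((\<lambda>u'. F u' v t) has_derivative (\<lambda>a. partial_y F u v t *v a)) (at u within UNIV)"
      using F t by (simp add: smooth_data_def partial_y_def jacobian_works[symmetric])
    show "((\<lambda>v'. F u' v' t) has_derivative blinfun_apply (D u' v')) (at v' within UNIV)" for u' v'
      using F t by (simp add: D smooth_data_def partial_z_def jacobian_works[symmetric])
    have cont: "continuous_on (UNIV \<times> UNIV \<times> {0..T}) (\<lambda>(u, v, t). partial_z F u v t)"
      using F by (simp add: smooth_data_def)
    have "continuous_on UNIV (\<lambda>p. partial_z F (fst p) (snd p) t)"
      using t by (intro continuous_on_compose2[OF cont, of _ "\<lambda>p. (fst p, snd p, t)", simplified])
        (auto intro!: continuous_intros)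
    then have "continuous (at (u, v)) (\<lambda>p. partial_z F (fst p) (snd p) t)"
      by (simp add: continuous_on_eq_continuous_at)
    then have "continuous (at (u, v)) (\<lambda>p. D (fst p) (snd p))"
      by (intro continuous_blinfun_componentwiseI1)
        (simp add: D bounded_linear.continuous[OF bounded_linear_matrix_vector_left])
    then show "continuous (at (u, v) within UNIV \<times> UNIV) (\<lambda>(u, v). D u v)"
      by (simp add: split_def)
  qed auto
  then show ?thesis by (simp add: D)
qed

text \<open>This is why the adjoint is built from averages of the partial derivatives along the segment
  from the numerical to the true solution: they linearize the difference exactly, with no
  quadratic remainder. The identity is the fundamental theorem of calculus along that segment.\<close>

lemma mean_value_linearization:
  fixes F :: "real^'n \<Rightarrow> real^'m \<Rightarrow> real \<Rightarrow> real^'k"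
  assumes F: "smooth_data T F" and t: "t \<in> {0..T}"
  shows "F (y t) (z t) t - F (Y t) (Z t) t
       = mean_partial_y F y z Y Z t *v (y t - Y t) + mean_partial_z F y z Y Z t *v (z t - Z t)"
proof -
  let ?u = "\<lambda>s. s *\<^sub>R y t + (1 - s) *\<^sub>R Y t" and ?v = "\<lambda>s. s *\<^sub>R z t + (1 - s) *\<^sub>R Z t"
  let ?A = "\<lambda>s. partial_y F (?u s) (?v s) t" and ?B = "\<lambda>s. partial_z F (?u s) (?v s) t"
  have "((\<lambda>s. F (?u s) (?v s) t) has_vector_derivative ?A s *v (y t - Y t) + ?B s *v (z t - Z t))
          (at s within {0..1})" for s
  proof -
    have "((\<lambda>s. (?u s, ?v s)) has_derivative (\<lambda>h. h *\<^sub>R (y t - Y t, z t - Z t))) (at s within {0..1})"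
      by (auto intro!: derivative_eq_intros simp: algebra_simps)
    from has_derivative_compose[OF this smooth_data_has_derivative[OF F t]]
    show ?thesis
      by (simp add: has_vector_derivative_def matrix_vector_mult_scaleR scaleR_add_right)
  qed
  from fundamental_theorem_of_calculus[OF zero_le_one this]
  have whole: "((\<lambda>s. ?A s *v (y t - Y t) + ?B s *v (z t - Z t)) has_integral
          F (y t) (z t) t - F (Y t) (Z t) t) {0..1}" by simp
  have cont: "continuous_on (UNIV \<times> UNIV \<times> {0..T}) (\<lambda>(u, v, t). partial_y F u v t)"
    "continuous_on (UNIV \<times> UNIV \<times> {0..T}) (\<lambda>(u, v, t). partial_z F u v t)"
    using F by (simp_all add: smooth_data_def)
  have A: "?A integrable_on {0..1}" and B: "?B integrable_on {0..1}"
    using t by (auto intro!: integrable_continuous_real continuous_intros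
        continuous_on_compose2[OF cont(1), of _ "\<lambda>s. (?u s, ?v s, t)", simplified]
        continuous_on_compose2[OF cont(2), of _ "\<lambda>s. (?u s, ?v s, t)", simplified])
  have "((\<lambda>s. ?A s *v (y t - Y t) + ?B s *v (z t - Z t)) has_integral
          mean_partial_y F y z Y Z t *v (y t - Y t) + mean_partial_z F y z Y Z t *v (z t - Z t)) {0..1}"
    unfolding mean_partial_y_def mean_partial_z_def
    using has_integral_linear[OF integrable_integral[OF A] bounded_linear_matrix_vector_left]
      has_integral_linear[OF integrable_integral[OF B] bounded_linear_matrix_vector_left]
    by (intro has_integral_add) (simp_all add: o_def)
  with whole show ?thesis by (rule has_integral_unique)
qed

section \<open>Piecewise linear interpolants\<close>

lemma grid_cell_exists:
  assumes "0 < h" "0 < N" "t \<in> {0..real N * h}"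
  shows "\<exists>k<N. t \<in> {real k * h..real (Suc k) * h}"
proof (cases "t = real N * h")
  case True
  with assms show ?thesis by (intro exI[of _ "N - 1"]) (auto simp: of_nat_diff field_simps)
next
  case False
  define k where "k = nat \<lfloor>t / h\<rfloor>"
  have k: "real k \<le> t / h" "t / h < real k + 1"
    using assms by (auto simp: k_def)
  have "real k * h \<le> t" using k(1) \<open>0 < h\<close> by (simp add: field_simps)
  also have "t < real N * h" using False assms(3) by auto
  finally have "k < N" using \<open>0 < h\<close> by simp
  moreover have "t \<in> {real k * h..real (Suc k) * h}" using k assms by (simp add: field_simps)
  ultimately show ?thesis by auto
qed

lemma linear_interpolant_continuous_on:
  fixes x :: "real \<Rightarrow> 'a::real_normed_vector"
  assumes x: "linear_interpolant h N X x" and "0 < h" "0 < N"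
  shows "continuous_on {0..real N * h} x"
proof -
  let ?I = "\<lambda>k. {real k * h..real (Suc k) * h}"
  have "continuous_on (\<Union>k\<in>{..<N}. ?I k) x"
  proof (rule continuous_on_closed_Union)
    fix k assume "k \<in> {..<N}"
    then have "\<forall>t\<in>?I k. X k + ((t - real k * h) / h) *\<^sub>R (X (Suc k) - X k) = x t"
      using x by (simp add: linear_interpolant_def)
    moreover have "continuous_on (?I k) (\<lambda>t. X k + ((t - real k * h) / h) *\<^sub>R (X (Suc k) - X k))"
      using \<open>0 < h\<close> by (intro continuous_intros) auto
    ultimately show "continuous_on (?I k) x" by (metis (no_types, lifting) continuous_on_cong)
  qed auto
  then show ?thesis
    by (rule continuous_on_subset) (use grid_cell_exists[OF \<open>0 < h\<close> \<open>0 < N\<close>] in blast)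
qed

lemma linear_interpolant_has_vector_derivative:
  fixes x :: "real \<Rightarrow> 'a::real_normed_vector"
  assumes x: "linear_interpolant h N X x" and "0 < h" "0 < N"
    and t: "t \<in> {0..real N * h} - (\<lambda>k. real k * h) ` {..N}"
  shows "\<exists>k<N. (x has_vector_derivative (1 / h) *\<^sub>R (X (Suc k) - X k)) (at t)"
proof -
  obtain k where k: "k < N" "t \<in> {real k * h..real (Suc k) * h}"
    using grid_cell_exists[OF \<open>0 < h\<close> \<open>0 < N\<close>] t by blast
  moreover have "t \<noteq> real k * h" "t \<noteq> real (Suc k) * h"
    using t \<open>k < N\<close> by (auto simp del: of_nat_Suc simp: image_iff Suc_le_eq dest: bspec[of _ _ k] bspec[of _ _ "Suc k"])
  ultimately have t: "t \<in> {real k * h<..<real (Suc k) * h}" by auto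
  have "((\<lambda>t. X k + ((t - real k * h) / h) *\<^sub>R (X (Suc k) - X k))
          has_vector_derivative (1 / h) *\<^sub>R (X (Suc k) - X k)) (at t)"
    using \<open>0 < h\<close> by (auto intro!: derivative_eq_intros)
  then have "(x has_vector_derivative (1 / h) *\<^sub>R (X (Suc k) - X k)) (at t)"
    by (rule has_vector_derivative_transform_within_open[OF _ open_greaterThanLessThan t])
      (use x k(1) in \<open>auto simp: linear_interpolant_def\<close>)
  with k(1) show ?thesis by blast
qed

lemma linear_interpolant_at_node:
  assumes x: "linear_interpolant h N X x" and "0 < h" "0 < N" "k \<le> N"
  shows "x (real k * h) = X k"
proof (cases k)
  case 0
  with assms show ?thesis by (auto simp: linear_interpolant_def)
next
  case (Suc j)
  with x \<open>k \<le> N\<close> \<open>0 < h\<close>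
  have "x (real k * h) = X j + ((real k * h - real j * h) / h) *\<^sub>R (X k - X j)"
    by (simp add: linear_interpolant_def Suc_le_eq)
  moreover have "(real k * h - real j * h) / h = 1"
    using Suc \<open>0 < h\<close> by (simp add: field_simps)
  ultimately show ?thesis by simp
qed

section \<open>Integrability and matrix identities\<close>

lemma square_integrable_imp_absolutely_integrable:
  fixes x :: "real \<Rightarrow> 'a::euclidean_space"
  assumes "square_integrable_on x {a..b}"
  shows "x absolutely_integrable_on {a..b}"
proof (rule measurable_bounded_by_integrable_imp_absolutely_integrable)
  show "x \<in> borel_measurable (lebesgue_on {a..b})"
    using assms by (simp add: square_integrable_on_def)
  have "integrable (lebesgue_on {a..b}) (\<lambda>t. (norm (x t))\<^sup>2)"
    using assms by (simp add: square_integrable_on_def)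
  then have "(\<lambda>t. (norm (x t))\<^sup>2) integrable_on {a..b}"
    by (simp add: integrable_on_lebesgue_on)
  then show "(\<lambda>t. 1 + (norm (x t))\<^sup>2) integrable_on {a..b}"
    by (intro integrable_add) auto
  show "norm (x t) \<le> 1 + (norm (x t))\<^sup>2" for t
    \<comment> \<open>the square of \<open>norm (x t) - 1/2\<close> is nonnegative\<close>
    using zero_le_power2[of "norm (x t) - 1/2"] by (simp add: power2_eq_square algebra_simps)
qed auto

lemma inner_transpose_matrix_vector:
  fixes A :: "real^'n^'m"
  shows "(transpose A *v u) \<bullet> w = u \<bullet> (A *v w)"
  by (simp add: dot_lmul_matrix)

lemma matrix_inv_vector_cancel:
  fixes A :: "real^'n^'n"
  assumes "invertible A"
  shows "A *v (matrix_inv A *v x) = x"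
proof -
  have "A ** matrix_inv A = mat 1"
    using assms unfolding invertible_def matrix_inv_def by (rule someI2_ex) simp
  then show ?thesis by (simp add: matrix_vector_mul_assoc)
qed

section \<open>The error representation\<close>

lemma smooth_data_continuous_along:
  assumes F: "smooth_data T F" and "continuous_on {0..T} u" "continuous_on {0..T} v"
  shows "continuous_on {0..T} (\<lambda>t. F (u t) (v t) t)"
proof -
  have "continuous_on (UNIV \<times> UNIV \<times> {0..T}) (\<lambda>(u, v, t). F u v t)"
    using F by (simp add: smooth_data_def)
  moreover have "continuous_on {0..T} (\<lambda>t. (u t, v t, t))"
    by (intro continuous_on_Pair continuous_on_id assms)
  moreover have "(\<lambda>t. (u t, v t, t)) ` {0..T} \<subseteq> UNIV \<times> UNIV \<times> {0..T}" by auto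
  ultimately have "continuous_on {0..T} (\<lambda>t. case (u t, v t, t) of (u, v, t) \<Rightarrow> F u v t)"
    by (rule continuous_on_compose2)
  then show ?thesis by simp
qed

text \<open>The adjoint terminal value is designed for this identity. The linearized constraint expresses
  the error in the algebraic variable as \<open>- Gz\<^sup>-\<^sup>1 Gy ey\<close>, and moving these matrices to the
  other side of the inner product turns the functional of both errors into one of
  \<^term>\<open>ey\<close> alone.\<close>

lemma terminal_error_dual:
  fixes Gy :: "real^'n^'m" and Gz :: "real^'m^'m"
  assumes inv: "invertible Gz" and constraint: "Gy *v ey + Gz *v ez = 0"
  shows "ey \<bullet> \<zeta>y + ez \<bullet> \<zeta>z
       = (\<zeta>y - transpose Gy *v (matrix_inv (transpose Gz) *v \<zeta>z)) \<bullet> ey"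
proof -
  define p where "p = matrix_inv (transpose Gz) *v \<zeta>z"
  have "transpose Gz *v p = \<zeta>z"
    unfolding p_def by (intro matrix_inv_vector_cancel transpose_invertible inv)
  then have "ez \<bullet> \<zeta>z = p \<bullet> (Gz *v ez)"
    using inner_transpose_matrix_vector[of Gz p ez] by (simp add: inner_commute)
  also have "Gz *v ez = - (Gy *v ey)"
    using constraint by (simp add: add_eq_0_iff)
  finally have "ez \<bullet> \<zeta>z = - ((transpose Gy *v p) \<bullet> ey)"
    by (simp only: inner_transpose_matrix_vector inner_minus_right)
  then show ?thesis
    unfolding p_def[symmetric] by (simp only: inner_diff_left inner_commute[of ey \<zeta>y])
qed

text \<open>The pointwise cancellation: the left-hand side is the derivative of the inner product of the
  adjoint \<^term>\<open>p\<close> with the error \<^term>\<open>ey\<close>. The differential adjoint equation removes the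
  terms in \<^term>\<open>Fy\<close>. The algebraic one trades \<^term>\<open>Fz\<close> for \<^term>\<open>Gz\<close>, which completes the
  linearization of the constraint and leaves its residual \<^term>\<open>gX\<close>.\<close>

lemma adjoint_pairing_residual:
  fixes Fy :: "real^'n^'n" and Fz :: "real^'m^'n" and Gy :: "real^'n^'m" and Gz :: "real^'m^'m"
  assumes F: "fx - fX = Fy *v ey + Fz *v ez" and G: "gx - gX = Gy *v ey + Gz *v ez"
    and "gx = 0" and alg: "transpose Fz *v p + transpose Gz *v q = 0"
  shows "p \<bullet> (fx - dY) + (- (transpose Fy *v p + transpose Gy *v q)) \<bullet> ey
       = p \<bullet> (fX - dY) + q \<bullet> gX"
proof -
  have 1: "p \<bullet> (Fz *v ez) + q \<bullet> (Gz *v ez) = 0"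
    using arg_cong[OF alg, of "\<lambda>v. v \<bullet> ez"]
    by (simp only: inner_add_left inner_transpose_matrix_vector inner_zero_left)
  have 2: "p \<bullet> fx - p \<bullet> fX = p \<bullet> (Fy *v ey) + p \<bullet> (Fz *v ez)"
    using arg_cong[OF F, of "inner p"] by (simp only: inner_add_right inner_diff_right)
  have 3: "- (q \<bullet> gX) = q \<bullet> (Gy *v ey) + q \<bullet> (Gz *v ez)"
    using arg_cong[OF G, of "inner q"] \<open>gx = 0\<close> by (simp add: inner_add_right)
  show ?thesis
    unfolding inner_minus_left inner_add_left inner_diff_right inner_transpose_matrix_vector
    using 1 2 3 by linarith
qed

theorem theorem3p3:
  fixes f :: "real^'n \<Rightarrow> real^'m \<Rightarrow> real \<Rightarrow> real^'n"
    and g :: "real^'n \<Rightarrow> real^'m \<Rightarrow> real \<Rightarrow> real^'m"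
    and T :: real and N :: nat
    and y Y \<phi>y :: "real \<Rightarrow> real^'n" and z Z \<phi>z :: "real \<Rightarrow> real^'m"
    and Yn :: "nat \<Rightarrow> real^'n" and Zn :: "nat \<Rightarrow> real^'m"
    and \<zeta>y :: "real^'n" and \<zeta>z :: "real^'m"
  assumes "T > 0" and "N > 0"
    and "smooth_data T f" and "smooth_data T g"
    and "dae_solution f g T y z" and "index1_along g T y z"
    and "bdf1_values f g (T / real N) N (y 0) (z 0) Yn Zn"
    and "linear_interpolant (T / real N) N Yn Y"
    and "linear_interpolant (T / real N) N Zn Z"
    and "\<forall>t\<in>{0..T}. invertible (mean_partial_z g y z Y Z t)"
    and "adjoint_solution
           (mean_partial_y f y z Y Z) (mean_partial_z f y z Y Z)
           (mean_partial_y g y z Y Z) (mean_partial_z g y z Y Z) T \<zeta>y \<zeta>z \<phi>y \<phi>z"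
  shows "terminal_qoi T \<zeta>y \<zeta>z y z - terminal_qoi T \<zeta>y \<zeta>z Y Z
           = (y T - Y T) \<bullet> \<zeta>y + (z T - Z T) \<bullet> \<zeta>z \<and>
         terminal_qoi T \<zeta>y \<zeta>z y z - terminal_qoi T \<zeta>y \<zeta>z Y Z
           = \<phi>y 0 \<bullet> (y 0 - Y 0)
             + L2_pairing T \<phi>y
                 (\<lambda>t. f (Y t) (Z t) t - vector_derivative Y (at t within {0..T}))
             + L2_pairing T \<phi>z (\<lambda>t. g (Y t) (Z t) t)"
proof -
  let ?h = "T / real N"
  let ?dY = "\<lambda>t. vector_derivative Y (at t within {0..T})"
  let ?fy = "mean_partial_y f y z Y Z" and ?fz = "mean_partial_z f y z Y Z"
    and ?gy = "mean_partial_y g y z Y Z" and ?gz = "mean_partial_z g y z Y Z"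
  have h: "0 < ?h" "real N * ?h = T" using \<open>T > 0\<close> \<open>N > 0\<close> by auto
  note Y = \<open>linear_interpolant ?h N Yn Y\<close> and Z = \<open>linear_interpolant ?h N Zn Z\<close>
  note sol = \<open>dae_solution f g T y z\<close>[unfolded dae_solution_def]
  note adj = \<open>adjoint_solution ?fy ?fz ?gy ?gz T \<zeta>y \<zeta>z \<phi>y \<phi>z\<close>[unfolded adjoint_solution_def]
  have contY: "continuous_on {0..T} Y" and contZ: "continuous_on {0..T} Z"
    using linear_interpolant_continuous_on[OF Y h(1) \<open>N > 0\<close>]
      linear_interpolant_continuous_on[OF Z h(1) \<open>N > 0\<close>] h(2) by simp_all
  have dy: "(y has_vector_derivative f (y t) (z t) t) (at t within {0..T})" if "t \<in> {0..T}" for t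
    using sol that by blast
  have conty: "continuous_on {0..T} y"
    unfolding continuous_on_eq_continuous_within using dy has_vector_derivative_continuous by blast
  have contz: "continuous_on {0..T} z" using sol by blast
  have contfy: "continuous_on {0..T} (\<lambda>t. f (y t) (z t) t)"
    and contfY: "continuous_on {0..T} (\<lambda>t. f (Y t) (Z t) t)"
    and contgY: "continuous_on {0..T} (\<lambda>t. g (Y t) (Z t) t)"
    using \<open>smooth_data T f\<close> \<open>smooth_data T g\<close> contY contZ conty contz
    by (simp_all add: smooth_data_continuous_along)

  \<comment> \<open>Off the finitely many nodes the interpolant has one of finitely many slopes.\<close>
  define S where "S = (\<lambda>k. real k * ?h) ` {..N}"
  have "finite S" by (simp add: S_def)
  have "0 \<in> S" "T \<in> S" using h(2) by (force simp: S_def image_iff)+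
  obtain B where "0 \<le> B" and slope: "\<And>t. t \<in> {0..T} - S \<Longrightarrow>
      \<exists>s. norm s \<le> B \<and> (Y has_vector_derivative s) (at t)"
  proof
    let ?B = "\<Sum>k<N. norm ((1 / ?h) *\<^sub>R (Yn (Suc k) - Yn k))"
    show "0 \<le> ?B" by (intro sum_nonneg) simp
    fix t assume "t \<in> {0..T} - S"
    then obtain k where "k < N" "(Y has_vector_derivative (1 / ?h) *\<^sub>R (Yn (Suc k) - Yn k)) (at t)"
      using linear_interpolant_has_vector_derivative[OF Y h(1) \<open>N > 0\<close>] h(2) by (auto simp: S_def)
    moreover have "norm ((1 / ?h) *\<^sub>R (Yn (Suc k) - Yn k)) \<le> ?B"
      using \<open>k < N\<close> by (intro member_le_sum) auto
    ultimately show "\<exists>s. norm s \<le> ?B \<and> (Y has_vector_derivative s) (at t)" by blast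
  qed
  have dY: "(Y has_vector_derivative ?dY t) (at t)" "norm (?dY t) \<le> B" if t: "t \<in> {0..T} - S" for t
  proof -
    obtain s where s: "norm s \<le> B" "(Y has_vector_derivative s) (at t)" using slope[OF t] by blast
    have "?dY t = s"
      using t \<open>T > 0\<close>
      by (intro vector_derivative_within_closed_interval has_vector_derivative_at_within[OF s(2)]) auto
    with s show "(Y has_vector_derivative ?dY t) (at t)" "norm (?dY t) \<le> B" by simp_all
  qed

  \<comment> \<open>Both solutions are Lipschitz, which makes the error absolutely continuous.\<close>
  have "B-lipschitz_on {0..T} Y"
    by (rule bounded_derivative_imp_lipschitz[OF contY \<open>finite S\<close> \<open>0 \<le> B\<close>]) (use dY in auto)
  moreover obtain C where "C-lipschitz_on {0..T} y"
  proof -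
    have "bounded ((\<lambda>t. f (y t) (z t) t) ` {0..T})"
      by (intro compact_imp_bounded compact_continuous_image contfy) simp
    then obtain C where "0 < C" "\<And>t. t \<in> {0..T} \<Longrightarrow> norm (f (y t) (z t) t) \<le> C"
      unfolding bounded_pos by auto
    moreover have "(y has_vector_derivative f (y t) (z t) t) (at t)" if "t \<in> {0<..<T}" for t
      using dy[of t] that at_within_Icc_at[of 0 t T] by simp
    ultimately have "C-lipschitz_on {0..T} y"
      by (intro bounded_derivative_imp_lipschitz[OF conty finite.emptyI]) auto
    then show ?thesis by (rule that)
  qed
  ultimately have ac_err: "abs_continuous_on_interval 0 T (\<lambda>t. y t - Y t)"
    using lipschitz_imp_abs_continuous lipschitz_on_diff by blast

  let ?D\<phi> = "\<lambda>t. - (transpose (?fy t) *v \<phi>y t + transpose (?gy t) *v \<phi>z t)"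
  let ?adj = "\<lambda>t. (\<phi>y has_vector_derivative ?D\<phi> t) (at t within {0..T})
      \<and> transpose (?fz t) *v \<phi>y t + transpose (?gz t) *v \<phi>z t = 0"
  have "AE t\<in>{0..<T} in lebesgue. ?adj t" using adj by blast
  then obtain E where "negligible E" and "{t. \<not> (t \<in> {0..<T} \<longrightarrow> ?adj t)} \<subseteq> E"
    unfolding eventually_ae_filter_negligible by blast
  then have adjE: "?adj t" if "t \<in> {0..<T} - E" for t using that by blast
  define E' where "E' = E \<union> S"
  have "negligible E'"
    unfolding E'_def using \<open>negligible E\<close> \<open>finite S\<close> by (simp add: negligible_Un negligible_finite)
  have off: "t \<in> {0..<T} - E" "t \<in> {0..T} - S" "t \<in> {0..T}" if "t \<in> {0..T} - E'" for t
    using that \<open>T \<in> S\<close> by (auto simp: E'_def less_le)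

  have product: "((\<lambda>t. \<phi>y t \<bullet> (f (y t) (z t) t - ?dY t) + ?D\<phi> t \<bullet> (y t - Y t)) has_integral
          (\<phi>y T \<bullet> (y T - Y T) - \<phi>y 0 \<bullet> (y 0 - Y 0))) {0..T}"
  proof (rule abs_continuous_integration_by_parts[OF _ _ ac_err \<open>negligible E'\<close>])
    fix t assume t: "t \<in> {0..T} - E'"
    show "(\<phi>y has_vector_derivative ?D\<phi> t) (at t within {0..T})" using adjE off(1)[OF t] by blast
    show "((\<lambda>t. y t - Y t) has_vector_derivative f (y t) (z t) t - ?dY t) (at t within {0..T})"
      by (rule has_vector_derivative_diff[OF dy[OF off(3)[OF t]]
            has_vector_derivative_at_within[OF dY(1)[OF off(2)[OF t]]]])
  qed (use adj \<open>T > 0\<close> in auto)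
  have residual: "\<phi>y t \<bullet> (f (Y t) (Z t) t - ?dY t) + \<phi>z t \<bullet> g (Y t) (Z t) t
      = \<phi>y t \<bullet> (f (y t) (z t) t - ?dY t) + ?D\<phi> t \<bullet> (y t - Y t)" if t: "t \<in> {0..T} - E'" for t
  proof (rule adjoint_pairing_residual[symmetric])
    show "g (y t) (z t) t = 0" using sol off(3)[OF t] by blast
    show "transpose (?fz t) *v \<phi>y t + transpose (?gz t) *v \<phi>z t = 0" using adjE off(1)[OF t] by blast
    show "f (y t) (z t) t - f (Y t) (Z t) t = ?fy t *v (y t - Y t) + ?fz t *v (z t - Z t)"
      by (rule mean_value_linearization[OF \<open>smooth_data T f\<close> off(3)[OF t]])
    show "g (y t) (z t) t - g (Y t) (Z t) t = ?gy t *v (y t - Y t) + ?gz t *v (z t - Z t)"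
      by (rule mean_value_linearization[OF \<open>smooth_data T g\<close> off(3)[OF t]])
  qed
  have parts: "((\<lambda>t. \<phi>y t \<bullet> (f (Y t) (Z t) t - ?dY t) + \<phi>z t \<bullet> g (Y t) (Z t) t) has_integral
          (\<phi>y T \<bullet> (y T - Y T) - \<phi>y 0 \<bullet> (y 0 - Y 0))) {0..T}"
    by (rule has_integral_spike[OF \<open>negligible E'\<close> residual product])

  \<comment> \<open>To split the integral into the two pairings, each summand must be Lebesgue integrable on
     its own. In both cases it is the product of a bounded measurable and an integrable factor,
     up to a continuous function.\<close>
  have cont\<phi>y: "continuous_on {0..T} \<phi>y" using adj abs_continuous_imp_continuous_on by blast
  have "(\<lambda>t. ?dY t \<bullet> \<phi>y t) absolutely_integrable_on {0..T}"
  proof (rule absolutely_integrable_bounded_measurable_product[where h = "(\<bullet>)"])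
    have "(?dY has_integral (Y T - Y 0)) {0..T}"
      using dY(1) \<open>T > 0\<close> contY by (intro fundamental_theorem_of_calculus_interior_strong[OF \<open>finite S\<close>]) auto
    then show "?dY \<in> borel_measurable (lebesgue_on {0..T})"
      by (intro integrable_imp_measurable) blast
    have "?dY t \<in> ?dY ` S \<union> cball 0 B" if "t \<in> {0..T}" for t
      using that dY(2)[of t] by (cases "t \<in> S") auto
    then have "?dY ` {0..T} \<subseteq> ?dY ` S \<union> cball 0 B" by blast
    then show "bounded (?dY ` {0..T})"
      by (rule bounded_subset[rotated]) (simp add: finite_imp_bounded \<open>finite S\<close>)
    show "\<phi>y absolutely_integrable_on {0..T}"
      by (rule absolutely_integrable_continuous_real[OF cont\<phi>y])
  qed (use bilinear_conv_bounded_bilinear bounded_bilinear_inner in auto)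
  moreover have "(\<lambda>t. \<phi>y t \<bullet> f (Y t) (Z t) t) absolutely_integrable_on {0..T}"
    by (intro absolutely_integrable_continuous_real continuous_intros cont\<phi>y contfY)
  ultimately have int_f: "(\<lambda>t. \<phi>y t \<bullet> (f (Y t) (Z t) t - ?dY t)) absolutely_integrable_on {0..T}"
    using set_integral_diff(1)[of lebesgue "{0..T}" "\<lambda>t. \<phi>y t \<bullet> f (Y t) (Z t) t" "\<lambda>t. ?dY t \<bullet> \<phi>y t"]
    by (simp add: inner_diff_right inner_commute)
  have "(\<lambda>t. g (Y t) (Z t) t \<bullet> \<phi>z t) absolutely_integrable_on {0..T}"
  proof (rule absolutely_integrable_bounded_measurable_product[where h = "(\<bullet>)"])
    show "(\<lambda>t. g (Y t) (Z t) t) \<in> borel_measurable (lebesgue_on {0..T})"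
      by (intro continuous_imp_measurable_on_sets_lebesgue contgY) simp
    show "bounded ((\<lambda>t. g (Y t) (Z t) t) ` {0..T})"
      by (intro compact_imp_bounded compact_continuous_image contgY) simp
    show "\<phi>z absolutely_integrable_on {0..T}"
      using adj square_integrable_imp_absolutely_integrable by blast
  qed (use bilinear_conv_bounded_bilinear bounded_bilinear_inner in auto)
  then have int_g: "(\<lambda>t. \<phi>z t \<bullet> g (Y t) (Z t) t) absolutely_integrable_on {0..T}"
    by (simp add: inner_commute)
  have "((\<lambda>t. \<phi>y t \<bullet> (f (Y t) (Z t) t - ?dY t) + \<phi>z t \<bullet> g (Y t) (Z t) t) has_integral
      L2_pairing T \<phi>y (\<lambda>t. f (Y t) (Z t) t - ?dY t) + L2_pairing T \<phi>z (\<lambda>t. g (Y t) (Z t) t)) {0..T}"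
    unfolding L2_pairing_def
    by (intro has_integral_add has_integral_set_lebesgue int_f int_g)
  from has_integral_unique[OF parts this] have dual: "\<phi>y T \<bullet> (y T - Y T) = \<phi>y 0 \<bullet> (y 0 - Y 0)
      + L2_pairing T \<phi>y (\<lambda>t. f (Y t) (Z t) t - ?dY t) + L2_pairing T \<phi>z (\<lambda>t. g (Y t) (Z t) t)"
    by linarith

  \<comment> \<open>The last implicit Euler step enforces the constraint at \<open>T\<close>, so there the linearized
     constraint is homogeneous.\<close>
  have "g (Y T) (Z T) T = 0"
  proof -
    have "g (Yn N) (Zn N) (real N * ?h) = 0"
      using \<open>bdf1_values f g ?h N (y 0) (z 0) Yn Zn\<close> \<open>N > 0\<close>
      unfolding bdf1_values_def by (cases N) auto
    moreover have "Y T = Yn N" "Z T = Zn N"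
      using linear_interpolant_at_node[OF Y h(1) \<open>N > 0\<close>, of N]
        linear_interpolant_at_node[OF Z h(1) \<open>N > 0\<close>, of N] h(2) by simp_all
    ultimately show ?thesis using h(2) by simp
  qed
  moreover have "g (y T) (z T) T = 0" using sol \<open>T > 0\<close> by auto
  ultimately have "?gy T *v (y T - Y T) + ?gz T *v (z T - Z T) = 0"
    using mean_value_linearization[OF \<open>smooth_data T g\<close>, of T y z Y Z] \<open>T > 0\<close> by simp
  then have "(y T - Y T) \<bullet> \<zeta>y + (z T - Z T) \<bullet> \<zeta>z
      = (\<zeta>y - transpose (?gy T) *v (matrix_inv (transpose (?gz T)) *v \<zeta>z)) \<bullet> (y T - Y T)"
    using \<open>\<forall>t\<in>{0..T}. invertible (?gz t)\<close> \<open>T > 0\<close> by (intro terminal_error_dual) auto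
  also have "\<dots> = \<phi>y T \<bullet> (y T - Y T)" using adj by metis
  finally have "(y T - Y T) \<bullet> \<zeta>y + (z T - Z T) \<bullet> \<zeta>z = \<phi>y T \<bullet> (y T - Y T)" .
  moreover have "terminal_qoi T \<zeta>y \<zeta>z y z - terminal_qoi T \<zeta>y \<zeta>z Y Z
      = (y T - Y T) \<bullet> \<zeta>y + (z T - Z T) \<bullet> \<zeta>z"
    by (simp add: terminal_qoi_def inner_diff_left)
  ultimately show ?thesis using dual by simp
qed

end
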